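(* Let $\mathcal{G} \subseteq \mathrm{S}_n(\mathbb{R}[\underline{x}])$ be such that $(R^2 - \Vert x \Vert^2) I_n \in N_{\mathcal{G}}$ for some real $R$, and let $F \in \mathrm{S}_n(\mathbb{R}[\underline{x}])$. Then the following are equivalent: (1) For every point $a \in \mathbb{R}^d$ and every nonzero positive semidefinite real symmetric $n \times n$ matrix $B$ such that $\mathrm{Tr}(G(a)B) \ge 0$ for every $G \in \mathcal{G}$, we have $\mathrm{Tr}(F(a)B) > 0$. (2) $F - \varepsilon I_n \in N_{\mathcal{G}}$ for some real $\varepsilon > 0$.
   Context: $\mathbb{R}[\underline{x}] = \mathbb{R}[x_1,\ldots,x_d]$; $\Vert x \Vert^2 = x_1^2 + \cdots + x_d^2$; $\sum \mathbb{R}[\underline{x}]^2$ is the set of all finite sums of squares of polynomials. $\mathrm{M}_n(\mathbb{R}[\underline{x}])$ is the algebra of $n\times n$ matrices over $\mathbb{R}[\underline{x}]$, $\mathrm{S}_n(\mathbb{R}[\underline{x}])$ is its subspace of symmetric matrices, and $\sum \mathrm{M}_n(\mathbb{R}[\underline{x}])^2$ is the set of all finite sums of matrices $H^T H$ with $H \in \mathrm{M}_n(\mathbb{R}[\underline{x}])$. A subset $N \subseteq \mathrm{S}_n(\mathbb{R}[\underline{x}])$ is a weak quadratic module if $N + N \subseteq N$, $\sigma H \in N$ for all $\sigma \in \sum \mathbb{R}[\underline{x}]^2$ and $H \in N$, and $\sum \mathrm{M}_n(\mathbb{R}[\underline{x}])^2 \subseteq N$. $N_{\mathcal{G}}$ is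 the smallest weak quadratic module containing $\mathcal{G}$. The set $\mathcal{G}$ may be infinite. *)

theory Defs
  imports "HOL-Analysis.Analysis" "HOL-Library.Poly_Mapping"
begin

text \<open>Polynomials over the reals in variables indexed by the finite type \<open>'d\<close>, so
  \<open>d = CARD('d)\<close>: finitely supported coefficient functions on exponent vectors, with the
  convolution product of \<^theory>\<open>HOL-Library.Poly_Mapping\<close>.\<close>

type_synonym 'd rpoly = "('d \<Rightarrow>\<^sub>0 nat) \<Rightarrow>\<^sub>0 real"

type_synonym ('d, 'n) pmat = "'d rpoly ^ 'n ^ 'n"

definition pconst :: "real \<Rightarrow> 'd rpoly" where
  "pconst c = Poly_Mapping.single 0 c"

definition pvar :: "'d \<Rightarrow> 'd rpoly" where
  "pvar i = Poly_Mapping.single (Poly_Mapping.single i 1) 1"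

definition peval :: "'d::finite rpoly \<Rightarrow> real ^ 'd \<Rightarrow> real" where
  "peval p a = (\<Sum>m\<in>Poly_Mapping.keys p. Poly_Mapping.lookup p m *
     (\<Prod>i\<in>UNIV. (a $ i) ^ Poly_Mapping.lookup m i))"

definition pnorm_sq :: "'d::finite rpoly" where
  "pnorm_sq = (\<Sum>i\<in>UNIV. (pvar i)\<^sup>2)"

definition mat_eval :: "('d::finite, 'n) pmat \<Rightarrow> real ^ 'd \<Rightarrow> real ^ 'n ^ 'n" where
  "mat_eval G a = (\<chi> i j. peval (G $ i $ j) a)"

definition sym_mats :: "('a ^ 'n ^ 'n) set" where
  "sym_mats = {A. transpose A = A}"

definition psd :: "real ^ 'n ^ 'n \<Rightarrow> bool" where
  "psd B \<longleftrightarrow> B \<in> sym_mats \<and> (\<forall>v. 0 \<le> v \<bullet> (B *v v))"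

definition sos :: "'d rpoly set" where
  "sos = {\<Sum>i<k. (f i)\<^sup>2 | (k::nat) f. True}"

definition mat_sos :: "('d, 'n::finite) pmat set" where
  "mat_sos = {\<Sum>i<k. transpose (H i) ** H i | (k::nat) (H :: nat \<Rightarrow> ('d, 'n) pmat). True}"

definition pmat_scale :: "'d rpoly \<Rightarrow> ('d, 'n::finite) pmat \<Rightarrow> ('d, 'n) pmat" where
  "pmat_scale s H = (\<chi> i j. s * H $ i $ j)"

definition weak_quadratic_module :: "('d, 'n::finite) pmat set \<Rightarrow> bool" where
  "weak_quadratic_module N \<longleftrightarrow>
     N \<subseteq> sym_mats \<and>
     (\<forall>A\<in>N. \<forall>B\<in>N. A + B \<in> N) \<and>
     (\<forall>s\<in>sos. \<forall>H\<in>N. pmat_scale s H \<in> N) \<and>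
     mat_sos \<subseteq> N"

text \<open>The intersection below is over a nonempty family only if \<open>\<G>\<close> consists of
  symmetric matrices; it is then the smallest weak quadratic module containing \<open>\<G>\<close>.\<close>

definition wqm_generated :: "('d, 'n::finite) pmat set \<Rightarrow> ('d, 'n) pmat set" where
  "wqm_generated \<G> = weak_quadratic_module hull \<G>"

lemma transpose_add': "transpose (A + B) = transpose A + transpose B"
  by (simp add: transpose_def vec_eq_iff)

lemma sum_sym_mats:
  fixes A :: "'i \<Rightarrow> 'a::comm_monoid_add ^ 'n ^ 'n"
  assumes "\<And>i. i \<in> I \<Longrightarrow> A i \<in> sym_mats"
  shows "sum A I \<in> sym_mats"
  using assms
  by (induction I rule: infinite_finite_induct)
     (auto simp: sym_mats_def transpose_add', simp_all add: transpose_def vec_eq_iff)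

lemma weak_quadratic_module_sym_mats:
  "weak_quadratic_module (sym_mats :: ('d, 'n::finite) pmat set)"
proof -
  have "transpose H ** H \<in> sym_mats" for H :: "('d, 'n) pmat"
    by (simp add: sym_mats_def matrix_transpose_mul)
  then have "(mat_sos :: ('d, 'n) pmat set) \<subseteq> sym_mats"
    unfolding mat_sos_def by (auto intro!: sum_sym_mats)
  moreover have "pmat_scale s H \<in> sym_mats" if "H \<in> sym_mats"
    for s :: "'d rpoly" and H :: "('d, 'n) pmat"
    using that by (simp add: sym_mats_def pmat_scale_def transpose_def vec_eq_iff)
  ultimately show ?thesis
    unfolding weak_quadratic_module_def by (auto simp: sym_mats_def transpose_add')
qed

lemma weak_quadratic_module_wqm_generated:
  fixes \<G> :: "('d, 'n::finite) pmat set"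
  assumes "\<G> \<subseteq> sym_mats"
  shows "weak_quadratic_module (wqm_generated \<G>)"
proof -
  have "wqm_generated \<G> \<subseteq> sym_mats"
    unfolding wqm_generated_def
    using assms weak_quadratic_module_sym_mats by (rule hull_minimal)
  then show ?thesis
    by (auto simp: weak_quadratic_module_def wqm_generated_def hull_def)
qed

end

theory Submission
  imports Defs
begin

text \<open>For the nontrivial direction, consider the module generated by \<open>\<G>\<close> and \<open>- F\<close>. If it
  contains \<open>- I\<close>, then \<open>g F - I\<close> lies in \<open>N\<^sub>\<G>\<close> for some sum of squares \<open>g\<close>, and the
  Archimedean property allows \<open>g\<close> to be replaced by a positive constant. Otherwise it extends, by
  Zorn's lemma, to a maximal module \<open>M\<close> without \<open>- I\<close>. The Archimedean property turns
  \<open>M\<close> into a closed half-space, hence into the nonnegativity cone of a linear functional \<open>L\<close> with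
  \<open>L(I) = 1\<close>. Since the kernel of \<open>L\<close> is stable under multiplication by squares,
  \<open>L(p H) = L(p I) L(H)\<close>. So \<open>L(H) = Tr (H(a) B)\<close> for a point \<open>a\<close> and a nonzero positive
  semidefinite \<open>B\<close>, and \<open>L(F) \<le> 0\<close> contradicts the positivity assumption.\<close>

subsection \<open>Polynomials\<close>

lemma pconst_simps:
  "pconst 0 = 0" "pconst 1 = 1"
  "pconst (a + b) = pconst a + pconst b" "pconst (a - b) = pconst a - pconst b"
  "pconst (- a) = - pconst a" "pconst (a * b) = pconst a * pconst b"
  "pconst (a ^ k) = pconst a ^ k"
proof -
  show m: "pconst (a * b) = pconst a * pconst b" for a b
    by (simp add: pconst_def mult_single)
  show o: "pconst 1 = 1" by (simp add: pconst_def)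
  show "pconst (a ^ k) = pconst a ^ k"
    by (induction k) (simp_all add: m o)
qed (simp_all add: pconst_def single_add single_diff single_uminus)

lemma pconst_2: "pconst 2 = 2"
  using pconst_simps(3)[of 1 1] by (simp add: pconst_simps(2))

lemma pconst_4: "pconst 4 = 4"
  using pconst_simps(6)[of 2 2] by (simp add: pconst_2)

lemma pconst_inverse: "pconst (1 / c) * pconst c = 1" if "c \<noteq> 0"
  using that by (simp add: pconst_simps(2) flip: pconst_simps(6))

lemma pconst_half_add: "pconst (1/2) * p + pconst (1/2) * p = p"
proof -
  have "pconst (1/2) + pconst (1/2) = 1"
    by (simp add: pconst_simps(2) flip: pconst_simps(3))
  then show ?thesis by (metis distrib_right mult_1)
qed

text \<open>Updating a finitely supported function at a fresh key amounts to adding a single term,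
  so \<open>update_induct\<close> turns into an induction along sums.\<close>

lemma poly_mapping_induct [case_names zero single add]:
  fixes f :: "'a \<Rightarrow>\<^sub>0 'b::monoid_add"
  assumes "P 0"
    and "\<And>k v. P (Poly_Mapping.single k v)"
    and "\<And>f g. P f \<Longrightarrow> P g \<Longrightarrow> P (f + g)"
  shows "P f"
proof (induction f rule: update_induct)
  case (update f k v)
  have "Poly_Mapping.update k v f = Poly_Mapping.single k v + f"
    using update(1)
    by (intro poly_mapping_eqI) (auto simp: lookup_update lookup_add lookup_single when_def in_keys_iff)
  then show ?case using assms update by simp
qed (rule assms)

text \<open>Constants and variables generate the polynomial ring: monomials are products of variable
  powers, and polynomials are sums of scaled monomials. This serves both the uniqueness of
  evaluation and the boundedness of squares in an Archimedean module.\<close>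

lemma rpoly_induct [case_names const var add mult]:
  fixes p :: "'d rpoly"
  assumes const: "\<And>c. P (pconst c)"
    and var: "\<And>i. P (pvar i)"
    and add: "\<And>p q. P p \<Longrightarrow> P q \<Longrightarrow> P (p + q)"
    and mult: "\<And>p q. P p \<Longrightarrow> P q \<Longrightarrow> P (p * q)"
  shows "P p"
proof -
  have one: "P 1" using const[of 1] by (simp add: pconst_simps)
  have power: "P (Poly_Mapping.single (Poly_Mapping.single i n) 1)" for i n
  proof (induction n)
    case (Suc n)
    have "Poly_Mapping.single (Poly_Mapping.single i (Suc n)) 1 =
        pvar i * Poly_Mapping.single (Poly_Mapping.single i n) (1::real)"
      by (simp add: pvar_def mult_single flip: single_add)
    then show ?case using mult[OF var Suc] by metis
  qed (simp add: one)
  have monomial: "P (Poly_Mapping.single m 1)" for m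
  proof (induction m rule: poly_mapping_induct)
    case (add f g)
    then show ?case using mult[OF add] by (simp add: mult_single)
  qed (simp_all add: one power)
  show ?thesis
  proof (induction p rule: poly_mapping_induct)
    case (single k v)
    have "Poly_Mapping.single k v = pconst v * Poly_Mapping.single k 1"
      by (simp add: pconst_def mult_single)
    then show ?case using mult[OF const monomial] by metis
  qed (use const[of 0] in \<open>simp_all add: pconst_simps add\<close>)
qed

section \<open>Evaluation as a ring homomorphism\<close>

lemma peval_superset:
  assumes "finite S" "Poly_Mapping.keys p \<subseteq> S"
  shows "peval p a = (\<Sum>m\<in>S. Poly_Mapping.lookup p m *
     (\<Prod>i\<in>UNIV. (a $ i) ^ Poly_Mapping.lookup m i))"
  unfolding peval_def
  by (intro sum.mono_neutral_left assms) (auto simp: in_keys_iff)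

lemma peval_single:
  "peval (Poly_Mapping.single m c) a = c * (\<Prod>i\<in>UNIV. (a $ i) ^ Poly_Mapping.lookup m i)"
  by (subst peval_superset[where S = "{m}"]) auto

lemma peval_pconst [simp]: "peval (pconst c) a = c"
  by (simp add: pconst_def peval_single)

lemma peval_pvar [simp]: "peval (pvar i) a = a $ i"
proof -
  have "(\<Prod>j\<in>UNIV. (a $ j) ^ Poly_Mapping.lookup (Poly_Mapping.single i 1) j) =
      (\<Prod>j\<in>UNIV. if j = i then a $ j else 1)"
    by (intro prod.cong) (auto simp: lookup_single)
  then show ?thesis by (simp add: pvar_def peval_single)
qed

lemma peval_add [simp]: "peval (p + q) a = peval p a + peval q a"
proof -
  \<comment> \<open>Cancellation can make the support of \<open>p + q\<close> smaller than this
    union, so all three sums are taken over the union.\<close>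
  let ?S = "Poly_Mapping.keys p \<union> Poly_Mapping.keys q"
  have "Poly_Mapping.keys (p + q) \<subseteq> ?S"
    by (rule Poly_Mapping.keys_add)
  then show ?thesis
    by (simp add: peval_superset[where S = ?S] lookup_add distrib_right sum.distrib)
qed

lemma peval_zero [simp]: "peval 0 a = 0"
  by (simp add: peval_def)

lemma peval_sum [simp]: "peval (sum f S) a = (\<Sum>i\<in>S. peval (f i) a)"
  by (induction S rule: infinite_finite_induct) auto

lemma peval_mult [simp]: "peval (p * q) a = peval p a * peval q a"
proof (induction p rule: poly_mapping_induct)
  case (single k v)
  show ?case
  proof (induction q rule: poly_mapping_induct)
    case (single k' v')
    show ?case
      by (simp add: mult_single peval_single lookup_add power_add prod.distrib)
  qed (simp_all add: algebra_simps)
qed (simp_all add: algebra_simps)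

lemma peval_uminus [simp]: "peval (- p) a = - peval p a"
  by (metis add.right_inverse eq_neg_iff_add_eq_0 peval_add peval_zero add.commute)

lemma peval_diff [simp]: "peval (p - q) a = peval p a - peval q a"
  using peval_add[of p "- q" a] by simp

lemma peval_power [simp]: "peval (p ^ k) a = peval p a ^ k"
  using peval_pconst[of 1 a] by (induction k) (simp_all add: pconst_simps)

text \<open>A homomorphism fixing the constants is determined by the images of the variables. This
  later turns a multiplicative functional into a point.\<close>

lemma rpoly_hom_eq_peval:
  fixes h :: "'d::finite rpoly \<Rightarrow> real"
  assumes "\<And>c. h (pconst c) = c"
    and "\<And>p q. h (p + q) = h p + h q"
    and "\<And>p q. h (p * q) = h p * h q"
  shows "h p = peval p (\<chi> i. h (pvar i))"
  by (induction p rule: rpoly_induct) (simp_all add: assms)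

section \<open>The semiring of sums of squares\<close>

lemma zero_in_sos: "0 \<in> sos"
  unfolding sos_def by (auto intro!: exI[of _ 0])

lemma sos_add_square:
  assumes "s \<in> sos"
  shows "s + f\<^sup>2 \<in> sos"
proof -
  obtain k :: nat and g where "s = (\<Sum>i<k. (g i)\<^sup>2)"
    using assms unfolding sos_def by blast
  then have "s + f\<^sup>2 = (\<Sum>i<Suc k. ((g(k := f)) i)\<^sup>2)"
    by (auto intro!: sum.cong)
  then show ?thesis unfolding sos_def by blast
qed

lemma sos_induct [consumes 1, case_names zero add_square]:
  assumes "s \<in> sos"
    and "P 0"
    and "\<And>s f. s \<in> sos \<Longrightarrow> P s \<Longrightarrow> P (s + f\<^sup>2)"
  shows "P s"
proof -
  have "P (\<Sum>i<k. (f i)\<^sup>2) \<and> (\<Sum>i<k. (f i)\<^sup>2) \<in> sos" for f and k :: nat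
    by (induction k) (auto simp: assms(2) zero_in_sos intro: sos_add_square assms(3))
  then show ?thesis using assms(1) unfolding sos_def by blast
qed

lemma square_in_sos: "f\<^sup>2 \<in> sos"
  using sos_add_square[OF zero_in_sos] by simp

lemma sos_add: "s + t \<in> sos" if "s \<in> sos" "t \<in> sos"
  using that(2,1)
  by (induction t rule: sos_induct) (auto simp: add.assoc[symmetric] intro: sos_add_square)

lemma sos_mult: "s * t \<in> sos" if "s \<in> sos" "t \<in> sos"
proof -
  have "s * f\<^sup>2 \<in> sos" for f using that(1)
    by (induction s rule: sos_induct)
       (auto simp: zero_in_sos distrib_right power_mult_distrib[symmetric] intro: sos_add_square)
  with that(2) show ?thesis
    by (induction t rule: sos_induct) (auto simp: zero_in_sos distrib_left intro: sos_add)
qed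

lemma sos_sum: "sum f S \<in> sos" if "\<And>i. i \<in> S \<Longrightarrow> f i \<in> sos"
  using that
  by (induction S rule: infinite_finite_induct) (auto simp: zero_in_sos intro: sos_add)

lemma pconst_in_sos: "pconst c \<in> sos" if "c \<ge> 0"
  using square_in_sos[of "pconst (sqrt c)"] that by (simp flip: pconst_simps)

lemma peval_sos_nonneg: "peval s a \<ge> 0" if "s \<in> sos"
  using that by (induction s rule: sos_induct) auto

subsection \<open>Symmetric polynomial matrices\<close>

lemma pmat_scale_nth [simp]: "pmat_scale s H $ i $ j = s * H $ i $ j"
  by (simp add: pmat_scale_def)

lemma mat_nth [simp]: "mat p $ i $ j = (if i = j then p else 0)"
  by (simp add: mat_def)

lemma pmat_scale_simps:
  "pmat_scale s (A + B) = pmat_scale s A + pmat_scale s B"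
  "pmat_scale s (A - B) = pmat_scale s A - pmat_scale s B"
  "pmat_scale (s + t) A = pmat_scale s A + pmat_scale t A"
  "pmat_scale (s - t) A = pmat_scale s A - pmat_scale t A"
  "pmat_scale s (- A) = - pmat_scale s A"
  "pmat_scale (- s) A = - pmat_scale s A"
  "pmat_scale s (pmat_scale t A) = pmat_scale (s * t) A"
  "pmat_scale s (mat p) = mat (s * p)"
  "pmat_scale 0 A = 0" "pmat_scale s 0 = 0" "pmat_scale 1 A = A"
  by (simp_all add: vec_eq_iff algebra_simps)

lemma mat_simps:
  fixes p q :: "'a::ring_1"
  shows "mat (p + q) = mat p + mat q" "mat (p - q) = mat p - mat q" "mat (- p) = - mat p"
  by (simp_all add: vec_eq_iff)

lemma in_sym_mats_iff: "A \<in> sym_mats \<longleftrightarrow> (\<forall>i j. A $ i $ j = A $ j $ i)"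
  by (auto simp: sym_mats_def transpose_def vec_eq_iff)

lemma sym_mats_simps [simp]:
  "A \<in> sym_mats \<Longrightarrow> B \<in> sym_mats \<Longrightarrow> A + B \<in> sym_mats"
  "A \<in> sym_mats \<Longrightarrow> pmat_scale s A \<in> sym_mats"
  "mat p \<in> sym_mats"
  by (simp_all add: in_sym_mats_iff)

lemma sym_mats_diff [simp]:
  fixes A B :: "'a::ab_group_add ^ 'n ^ 'n"
  shows "A \<in> sym_mats \<Longrightarrow> B \<in> sym_mats \<Longrightarrow> A - B \<in> sym_mats"
    "A \<in> sym_mats \<Longrightarrow> - A \<in> sym_mats"
  by (simp_all add: in_sym_mats_iff)

lemma matrix_diff_ldistrib: "A ** (B - C) = A ** B - A ** C"
  and matrix_diff_rdistrib: "(B - C) ** D = B ** D - C ** D"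
  for A B C D :: "'a::ring_1 ^ 'n ^ 'n"
  by (simp_all add: matrix_matrix_mult_def vec_eq_iff sum_subtractf algebra_simps)

lemma transpose_mult_nth:
  "(transpose A ** B) $ i $ j = (\<Sum>k\<in>UNIV. A $ k $ i * B $ k $ j)"
  by (simp add: matrix_matrix_mult_def transpose_def)

lemma trace_mult_sym:
  fixes A B :: "real ^ 'n ^ 'n"
  assumes "B \<in> sym_mats"
  shows "trace (A ** B) = (\<Sum>i\<in>UNIV. \<Sum>j\<in>UNIV. A $ i $ j * B $ i $ j)"
  using assms by (simp add: trace_def matrix_matrix_mult_def in_sym_mats_iff)

subsection \<open>Nonnegativity of a trace functional on the generated module\<close>

text \<open>The half-space that bounds the generated module from outside: once it is known to be a
  weak quadratic module, minimality of the hull does the rest.\<close>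

definition trace_cone :: "real ^ 'd \<Rightarrow> real ^ 'n ^ 'n \<Rightarrow> ('d::finite, 'n::finite) pmat set" where
  "trace_cone a B = {H \<in> sym_mats. trace (mat_eval H a ** B) \<ge> 0}"

lemma trace_mat_eval:
  assumes "B \<in> sym_mats"
  shows "trace (mat_eval H a ** B) = (\<Sum>i\<in>UNIV. \<Sum>j\<in>UNIV. peval (H $ i $ j) a * B $ i $ j)"
  by (simp add: trace_mult_sym[OF assms] mat_eval_def)

lemma psd_quadratic_form:
  assumes "psd B"
  shows "0 \<le> (\<Sum>i\<in>UNIV. \<Sum>j\<in>UNIV. v i * v j * B $ i $ j)"
proof -
  have "0 \<le> (\<chi> i. v i) \<bullet> (B *v (\<chi> i. v i))"
    using assms unfolding psd_def by blast
  also have "\<dots> = (\<Sum>i\<in>UNIV. \<Sum>j\<in>UNIV. v i * v j * B $ i $ j)"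
    by (simp add: inner_vec_def matrix_vector_mult_def sum_distrib_left algebra_simps)
  finally show ?thesis .
qed

text \<open>For squares, moving the row index \<open>k\<close> to the outermost sum writes the trace
  of \<open>H(a)^T H(a) B\<close> as a sum of values of the quadratic form of \<open>B\<close>, one
  for each row of \<open>H(a)\<close>.\<close>

lemma weak_quadratic_module_trace_cone:
  fixes B :: "real ^ 'n ^ 'n"
  assumes "psd B"
  shows "weak_quadratic_module (trace_cone a B :: ('d::finite, 'n::finite) pmat set)"
proof -
  have sym: "B \<in> sym_mats" using assms by (simp add: psd_def)
  note tr = trace_mat_eval[OF sym]
  have square: "transpose H ** H \<in> trace_cone a B" for H :: "('d, 'n) pmat"
  proof -
    have "trace (mat_eval (transpose H ** H) a ** B) =
        (\<Sum>i\<in>UNIV. \<Sum>j\<in>UNIV. \<Sum>k\<in>UNIV.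
          peval (H $ k $ i) a * peval (H $ k $ j) a * B $ i $ j)"
      by (simp add: tr transpose_mult_nth sum_distrib_right)
    also have "\<dots> = (\<Sum>i\<in>UNIV. \<Sum>k\<in>UNIV. \<Sum>j\<in>UNIV.
          peval (H $ k $ i) a * peval (H $ k $ j) a * B $ i $ j)"
      by (intro sum.cong refl sum.swap)
    also have "\<dots> = (\<Sum>k\<in>UNIV. \<Sum>i\<in>UNIV. \<Sum>j\<in>UNIV.
          peval (H $ k $ i) a * peval (H $ k $ j) a * B $ i $ j)"
      by (rule sum.swap)
    also have "\<dots> \<ge> 0"
      by (intro sum_nonneg psd_quadratic_form assms)
    finally show ?thesis
      by (simp add: trace_cone_def sym_mats_def matrix_transpose_mul)
  qed
  have add: "A + C \<in> trace_cone a B" if "A \<in> trace_cone a B" "C \<in> trace_cone a B"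
    for A C :: "('d, 'n) pmat"
    using that by (simp add: trace_cone_def tr distrib_right sum.distrib)
  have scale: "pmat_scale s H \<in> trace_cone a B" if "s \<in> sos" "H \<in> trace_cone a B"
    for s and H :: "('d, 'n) pmat"
    using that peval_sos_nonneg[OF that(1), of a]
    by (simp add: trace_cone_def tr mult.assoc sum_distrib_left[symmetric])
  have zero: "0 \<in> trace_cone a B"
    by (simp add: trace_cone_def tr in_sym_mats_iff)
  have "(\<Sum>i<k. transpose (H i) ** H i) \<in> trace_cone a B"
    for k :: nat and H :: "nat \<Rightarrow> ('d, 'n) pmat"
    by (induction k) (auto intro: zero add square)
  then have "mat_sos \<subseteq> (trace_cone a B :: ('d, 'n) pmat set)"
    unfolding mat_sos_def by blast
  then show ?thesis
    unfolding weak_quadratic_module_def using add scale by (auto simp: trace_cone_def)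
qed

lemma trace_nonneg_wqm_generated:
  assumes "psd B" "\<G> \<subseteq> sym_mats" "\<forall>G\<in>\<G>. trace (mat_eval G a ** B) \<ge> 0"
    and "H \<in> wqm_generated \<G>"
  shows "trace (mat_eval H a ** B) \<ge> 0"
proof -
  have "wqm_generated \<G> \<subseteq> trace_cone a B"
    unfolding wqm_generated_def
    using assms by (intro hull_minimal weak_quadratic_module_trace_cone) (auto simp: trace_cone_def)
  then show ?thesis using assms(4) by (auto simp: trace_cone_def)
qed

text \<open>The diagonal is nonnegative, so without positive trace it vanishes. The quadratic form
  at \<open>e_j + e_i\<close> and \<open>e_j - e_i\<close> then gives both signs of each
  off-diagonal entry.\<close>

lemma trace_psd_pos:
  fixes B :: "real ^ 'n ^ 'n"
  assumes "psd B" "B \<noteq> 0"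
  shows "trace B > 0"
proof (rule ccontr)
  assume "\<not> trace B > 0"
  have sym: "B $ i $ j = B $ j $ i" for i j
    using assms by (simp add: psd_def in_sym_mats_iff)
  have form: "0 \<le> t\<^sup>2 * B $ i $ i + 2 * t * B $ i $ j + B $ j $ j" if "i \<noteq> j" for i j t
  proof -
    \<comment> \<open>The vector \<open>t e_i + e_j\<close>, written as a sum of indicators so that
      each sum collapses to two terms.\<close>
    let ?v = "\<lambda>k. (if k = i then t else 0) + (if k = j then 1 else 0)"
    have "(\<Sum>k\<in>UNIV. \<Sum>l\<in>UNIV. ?v k * ?v l * B $ k $ l) =
        (\<Sum>k\<in>UNIV. ?v k * (\<Sum>l\<in>UNIV. ?v l * B $ k $ l))"
      by (simp add: sum_distrib_left mult.assoc)
    also have "\<dots> = (\<Sum>k\<in>UNIV. ?v k * (t * B $ k $ i + B $ k $ j))"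
      by (simp add: distrib_right sum.distrib if_distribR if_distrib[where f = "\<lambda>x. x * _"] cong: if_cong)
    also have "\<dots> = t * (t * B $ i $ i + B $ i $ j) + (t * B $ j $ i + B $ j $ j)"
      by (simp add: distrib_right[of "if _ then _ else _"] sum.distrib
          if_distribR if_distrib[where f = "\<lambda>x. x * _"] cong: if_cong)
    finally show ?thesis
      using psd_quadratic_form[OF assms(1), of ?v] sym[of i j]
      by (simp add: power2_eq_square algebra_simps)
  qed
  have diag: "B $ i $ i \<ge> 0" for i
  proof -
    have "0 \<le> axis i 1 \<bullet> (B *v axis i 1)" using assms(1) unfolding psd_def by blast
    then show ?thesis by (simp add: inner_axis' matrix_vector_mult_basis column_def)
  qed
  have "trace B = 0"
    using \<open>\<not> trace B > 0\<close> sum_nonneg[of UNIV "\<lambda>i. B $ i $ i"] diag by (simp add: trace_def)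
  then have z: "B $ i $ i = 0" for i
    using diag by (simp add: trace_def sum_nonneg_eq_0_iff)
  have "B $ i $ j = 0" for i j
  proof (cases "i = j")
    case False
    then show ?thesis using form[of i j 1] form[of i j "- 1"] z by simp
  qed (simp add: z)
  then show False using assms(2) by (simp add: vec_eq_iff)
qed

subsection \<open>Archimedean weak quadratic modules\<close>

text \<open>Only the bound on the norm of \<open>x\<close> is assumed; that the identity matrix is
  an order unit is derived in \<open>order_unit\<close>.\<close>

locale archimedean_wqm =
  fixes M :: "('d::finite, 'n::finite) pmat set"
  assumes wqm: "weak_quadratic_module M"
    and ball: "\<exists>R::real. mat (pconst (R\<^sup>2) - pnorm_sq) \<in> M"
begin

section \<open>Closure rules, and bounding symmetric matrices by constants\<close>

lemma in_sym: "H \<in> M \<Longrightarrow> H \<in> sym_mats"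
  and add_in: "A \<in> M \<Longrightarrow> B \<in> M \<Longrightarrow> A + B \<in> M"
  and scale_in: "s \<in> sos \<Longrightarrow> H \<in> M \<Longrightarrow> pmat_scale s H \<in> M"
  using wqm by (auto simp: weak_quadratic_module_def)

lemma square_in: "transpose H ** H \<in> M" for H :: "('d, 'n) pmat"
proof -
  have "transpose H ** H = (\<Sum>i<(1::nat). transpose H ** H)"
    by simp
  then have "transpose H ** H \<in> mat_sos"
    unfolding mat_sos_def by (auto intro!: exI[of _ "1::nat"] exI[of _ "\<lambda>_. H"])
  then show ?thesis
    using wqm by (auto simp: weak_quadratic_module_def)
qed

lemma mat_sos_in: "mat s \<in> M" if "s \<in> sos"
  using scale_in[OF that square_in[of "mat 1"]] by (simp add: pmat_scale_simps)

lemma mat_add_in: "mat p \<in> M \<Longrightarrow> mat q \<in> M \<Longrightarrow> mat (p + q) \<in> M"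
  using add_in by (simp add: mat_simps)

lemma mat_mult_in: "s \<in> sos \<Longrightarrow> mat p \<in> M \<Longrightarrow> mat (s * p) \<in> M"
  using scale_in by (simp flip: pmat_scale_simps)

lemma const_in: "c \<ge> 0 \<Longrightarrow> mat (pconst c) \<in> M"
  by (simp add: mat_sos_in pconst_in_sos)

lemma zero_in: "0 \<in> M"
  using const_in[of 0] by (simp add: pconst_simps mat_0)

text \<open>Bounds on squares propagate through the ring operations. Sums use \<open>2 b + 2 c - (p
  + q)^2 = 2 (b - p^2) + 2 (c - q^2) + (p - q)^2\<close>, and products use
  \<open>b c - (p q)^2 = q^2 (b - p^2) + b (c - q^2)\<close>. The second identity has
  \<open>b\<close> as a multiplier, hence the nonnegativity of the bound in the claim.\<close>

lemma scalar_square_bounded: "\<exists>c\<ge>0. mat (pconst c - p\<^sup>2) \<in> M"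
proof (induction p rule: rpoly_induct)
  case (const c)
  show ?case
    by (intro exI[of _ "c\<^sup>2"]) (simp add: const_in flip: pconst_simps)
next
  case (var i)
  obtain R where R: "mat (pconst (R\<^sup>2) - pnorm_sq) \<in> M" using ball by blast
  have "pconst (R\<^sup>2) - (pvar i)\<^sup>2 =
      (pconst (R\<^sup>2) - pnorm_sq) + (\<Sum>j\<in>UNIV - {i}. (pvar j)\<^sup>2)"
    unfolding pnorm_sq_def by (subst sum.remove[of UNIV i]) simp_all
  moreover have "mat ((pconst (R\<^sup>2) - pnorm_sq) + (\<Sum>j\<in>UNIV - {i}. (pvar j)\<^sup>2)) \<in> M"
    by (intro mat_add_in R mat_sos_in sos_sum square_in_sos)
  ultimately have "mat (pconst (R\<^sup>2) - (pvar i)\<^sup>2) \<in> M"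
    by metis
  then show ?case by (intro exI[of _ "R\<^sup>2"]) simp
next
  case (add p q)
  then obtain b c where b: "b \<ge> 0" "mat (pconst b - p\<^sup>2) \<in> M"
    and c: "c \<ge> 0" "mat (pconst c - q\<^sup>2) \<in> M" by blast
  have "mat ((pconst b - p\<^sup>2) + (pconst b - p\<^sup>2) + ((pconst c - q\<^sup>2) + (pconst c - q\<^sup>2))
      + (p - q)\<^sup>2) \<in> M"
    by (intro mat_add_in b c mat_sos_in square_in_sos)
  also have "(pconst b - p\<^sup>2) + (pconst b - p\<^sup>2) + ((pconst c - q\<^sup>2) + (pconst c - q\<^sup>2))
      + (p - q)\<^sup>2 = pconst (2 * b + 2 * c) - (p + q)\<^sup>2"
    by (simp add: pconst_simps(3,6) pconst_2 power2_eq_square algebra_simps)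
  finally show ?case using b(1) c(1) by (intro exI[of _ "2 * b + 2 * c"]) simp
next
  case (mult p q)
  then obtain b c where b: "b \<ge> 0" "mat (pconst b - p\<^sup>2) \<in> M"
    and c: "c \<ge> 0" "mat (pconst c - q\<^sup>2) \<in> M" by blast
  have "mat (q\<^sup>2 * (pconst b - p\<^sup>2) + pconst b * (pconst c - q\<^sup>2)) \<in> M"
    by (intro mat_add_in mat_mult_in b c pconst_in_sos square_in_sos)
  also have "q\<^sup>2 * (pconst b - p\<^sup>2) + pconst b * (pconst c - q\<^sup>2) = pconst (b * c) - (p * q)\<^sup>2"
    by (simp add: pconst_simps power2_eq_square algebra_simps)
  finally show ?case using b(1) c(1) by (intro exI[of _ "b * c"]) simp
qed

text \<open>The parallelogram identity again: the cross terms of \<open>A + B\<close> and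
  \<open>A - B\<close> cancel without any commutation of matrices.\<close>

lemma square_bounded_sum:
  fixes H :: "'i \<Rightarrow> ('d, 'n) pmat"
  assumes "\<And>i. i \<in> S \<Longrightarrow> \<exists>c. mat (pconst c) - transpose (H i) ** H i \<in> M"
  shows "\<exists>c. mat (pconst c) - transpose (sum H S) ** sum H S \<in> M"
  using assms
proof (induction S rule: infinite_finite_induct)
  case (insert x S)
  let ?A = "H x" and ?B = "sum H S"
  obtain a where a: "mat (pconst a) - transpose ?A ** ?A \<in> M" using insert by blast
  obtain b where b: "mat (pconst b) - transpose ?B ** ?B \<in> M" using insert by blast
  let ?X = "mat (pconst a) - transpose ?A ** ?A" and ?Y = "mat (pconst b) - transpose ?B ** ?B"
  have "?X + ?X + (?Y + ?Y) + transpose (?A - ?B) ** (?A - ?B) \<in> M"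
    by (intro add_in a b square_in)
  also have "?X + ?X + (?Y + ?Y) + transpose (?A - ?B) ** (?A - ?B) =
      mat (pconst (2 * a + 2 * b)) - transpose (?A + ?B) ** (?A + ?B)"
    by (simp add: vec_eq_iff transpose_mult_nth pconst_simps(3,6) pconst_2 algebra_simps
        sum.distrib sum_subtractf)
  finally show ?case using insert by auto
qed (auto intro!: exI[of _ 0] simp: pconst_simps transpose_def matrix_matrix_mult_def zero_in
      vec_eq_iff[of _ 0] mat_0 zero_vec_def[symmetric])

text \<open>A matrix is the sum of its single-entry parts, and the square of such a part has only
  the diagonal entry \<open>p^2\<close>, which the scalar bound controls.\<close>

lemma square_bounded: "\<exists>c. mat (pconst c) - transpose H ** H \<in> M" for H :: "('d, 'n) pmat"
proof -
  define U :: "'n \<times> 'n \<Rightarrow> ('d, 'n) pmat" where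
    "U = (\<lambda>(i, j). \<chi> k l. if k = i \<and> l = j then H $ i $ j else 0)"
  have "\<exists>c. mat (pconst c) - transpose (U ij) ** U ij \<in> M" for ij
  proof -
    obtain i j where ij: "ij = (i, j)" by fastforce
    let ?p = "H $ i $ j"
    obtain c where c: "mat (pconst c - ?p\<^sup>2) \<in> M" using scalar_square_bounded by blast
    \<comment> \<open>With \<open>p\<close> on the diagonal except at \<open>j\<close>, the square
      of \<open>D\<close> supplies the \<open>p^2\<close> that \<open>(c - p^2) I\<close> lacks at
      the other diagonal positions.\<close>
    define D where "D = ((\<chi> k l. if k = l \<and> k \<noteq> j then ?p else 0) :: ('d, 'n) pmat)"
    have U: "(transpose (U ij) ** U ij) $ a $ b = (if a = j \<and> b = j then ?p\<^sup>2 else 0)" for a b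
    proof -
      have "(transpose (U ij) ** U ij) $ a $ b =
          (\<Sum>k\<in>UNIV. if k = i then (if a = j \<and> b = j then ?p\<^sup>2 else 0) else 0)"
        unfolding transpose_mult_nth
        by (intro sum.cong) (auto simp: U_def ij power2_eq_square)
      then show ?thesis by simp
    qed
    have D: "(transpose D ** D) $ a $ b = (if a = b \<and> a \<noteq> j then ?p\<^sup>2 else 0)" for a b
    proof -
      have "(transpose D ** D) $ a $ b =
          (\<Sum>k\<in>UNIV. if k = a then (if a = b \<and> a \<noteq> j then ?p\<^sup>2 else 0) else 0)"
        unfolding transpose_mult_nth
        by (intro sum.cong) (auto simp: D_def power2_eq_square)
      then show ?thesis by simp
    qed
    have "mat (pconst c) - transpose (U ij) ** U ij = mat (pconst c - ?p\<^sup>2) + transpose D ** D"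
      by (auto simp: vec_eq_iff U D)
    then show ?thesis using add_in[OF c square_in[of D]] by metis
  qed
  then have "\<exists>c. mat (pconst c) - transpose (sum U UNIV) ** sum U UNIV \<in> M"
    by (intro square_bounded_sum)
  moreover have "sum U UNIV = H"
  proof -
    have "sum U UNIV $ k $ l = H $ k $ l" for k l
    proof -
      have "sum U UNIV $ k $ l = (\<Sum>ij\<in>UNIV. if ij = (k, l) then H $ k $ l else 0)"
        unfolding sum_component by (intro sum.cong) (auto simp: U_def split: prod.splits)
      then show ?thesis by simp
    qed
    then show ?thesis by (simp add: vec_eq_iff)
  qed
  ultimately show ?thesis by simp
qed

text \<open>For symmetric \<open>H\<close>, adding \<open>c - H^2\<close> and
  \<open>(1 - H)^2\<close> leaves \<open>c + 1 - 2 H\<close>; halving gives the bound.\<close>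

lemma order_unit:
  assumes "H \<in> sym_mats"
  shows "\<exists>c\<ge>0. mat (pconst c) - H \<in> M"
proof -
  obtain c where c: "mat (pconst c) - transpose H ** H \<in> M" using square_bounded by blast
  let ?K = "mat 1 - H"
  \<comment> \<open>The absolute value makes the final constant
    \<open>(\<bar>c\<bar> + 1) / 2\<close> nonnegative.\<close>
  have "mat (pconst \<bar>c\<bar>) - transpose H ** H \<in> M"
    using add_in[OF const_in[of "\<bar>c\<bar> - c"] c] by (simp add: pconst_simps mat_simps)
  then have "pmat_scale (pconst (1/2)) ((mat (pconst \<bar>c\<bar>) - transpose H ** H) + transpose ?K ** ?K) \<in> M"
    by (intro scale_in add_in square_in pconst_in_sos) simp_all
  moreover have "pmat_scale (pconst (1/2)) ((mat (pconst \<bar>c\<bar>) - transpose H ** H) + transpose ?K ** ?K)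
      = mat (pconst ((\<bar>c\<bar> + 1) / 2)) - H"
  proof -
    have "transpose ?K ** ?K = mat 1 - H - H + transpose H ** H"
    proof -
      have "transpose ?K = mat 1 - H" "transpose H = H"
        using assms by (auto simp: in_sym_mats_iff transpose_def vec_eq_iff mat_def)
      then show ?thesis
        by (simp add: matrix_diff_ldistrib matrix_diff_rdistrib)
    qed
    then have eq: "(mat (pconst \<bar>c\<bar>) - transpose H ** H) + transpose ?K ** ?K = mat (pconst (\<bar>c\<bar> + 1)) - H - H"
      by (simp add: pconst_simps mat_simps)
    moreover have "pmat_scale (pconst (1/2)) H + pmat_scale (pconst (1/2)) H = H"
      by (simp only: vec_eq_iff vector_add_component pmat_scale_nth pconst_half_add simp_thms)
    moreover have "pmat_scale (pconst (1/2)) (mat (pconst (\<bar>c\<bar> + 1)) - H - H) =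
        mat (pconst (1/2) * pconst (\<bar>c\<bar> + 1)) - (pmat_scale (pconst (1/2)) H + pmat_scale (pconst (1/2)) H)"
      by (simp only: pmat_scale_simps diff_diff_eq)
    ultimately show ?thesis
      unfolding eq by (simp flip: pconst_simps(6))
  qed
  ultimately show ?thesis by (intro exI[of _ "(\<bar>c\<bar> + 1) / 2"]) auto
qed

lemma order_unit':
  assumes "H \<in> sym_mats"
  obtains c where "c \<ge> 0" "mat (pconst c) - H \<in> M" "mat (pconst c) + H \<in> M"
proof -
  obtain b where b: "b \<ge> 0" "mat (pconst b) - H \<in> M" using order_unit[OF assms] by blast
  obtain c where c: "c \<ge> 0" "mat (pconst c) - - H \<in> M"
    using order_unit[of "- H"] assms by auto
  show thesis
  proof
    show "b + c \<ge> 0" using b c by simp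
    show "mat (pconst (b + c)) - H \<in> M"
      using add_in[OF b(2) const_in[OF c(1)]] by (simp add: pconst_simps mat_simps algebra_simps)
    show "mat (pconst (b + c)) + H \<in> M"
      using add_in[OF c(2) const_in[OF b(1)]] by (simp add: pconst_simps mat_simps algebra_simps)
  qed
qed

text \<open>For symmetric \<open>H\<close> this is the weak quadratic module generated by
  \<open>M\<close> and \<open>H\<close>. A single multiplier \<open>s\<close> suffices because
  \<open>sos\<close> is closed under sums and products.\<close>

definition adjoin :: "('d, 'n) pmat \<Rightarrow> ('d, 'n) pmat set" where
  "adjoin H = {A + pmat_scale s H | A s. A \<in> M \<and> s \<in> sos}"

lemma subset_adjoin: "M \<subseteq> adjoin H"
proof
  fix A assume "A \<in> M"
  then show "A \<in> adjoin H"
    unfolding adjoin_def using zero_in_sos by (force simp: pmat_scale_simps)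
qed

lemma in_adjoin: "H \<in> adjoin H"
  unfolding adjoin_def using zero_in pconst_in_sos[of 1]
  by (force simp: pmat_scale_simps pconst_simps)

lemma weak_quadratic_module_adjoin:
  assumes "H \<in> sym_mats"
  shows "weak_quadratic_module (adjoin H)"
  unfolding weak_quadratic_module_def
proof (intro conjI ballI)
  show "adjoin H \<subseteq> sym_mats" using assms in_sym by (auto simp: adjoin_def)
  show "mat_sos \<subseteq> adjoin H"
    using wqm subset_adjoin[of H] by (auto simp: weak_quadratic_module_def)
next
  fix X Y assume "X \<in> adjoin H" "Y \<in> adjoin H"
  then obtain A s B t where "X = A + pmat_scale s H" "Y = B + pmat_scale t H"
    and *: "A \<in> M" "B \<in> M" "s \<in> sos" "t \<in> sos" unfolding adjoin_def by blast
  then have "X + Y = (A + B) + pmat_scale (s + t) H"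
    by (simp add: pmat_scale_simps algebra_simps)
  then show "X + Y \<in> adjoin H" unfolding adjoin_def using * add_in sos_add by blast
next
  fix t :: "'d rpoly" and X assume "t \<in> sos" "X \<in> adjoin H"
  then obtain A s where "X = A + pmat_scale s H" and *: "A \<in> M" "s \<in> sos"
    unfolding adjoin_def by blast
  then have "pmat_scale t X = pmat_scale t A + pmat_scale (t * s) H"
    by (simp add: pmat_scale_simps)
  then show "pmat_scale t X \<in> adjoin H"
    unfolding adjoin_def using * \<open>t \<in> sos\<close> scale_in sos_mult by blast
qed

text \<open>Trading a sum-of-squares multiplier \<open>g\<close> for a strictly positive constant. With \<open>k\<close> a large
  constant, the identity
  \<open>k\<^sup>2 (F + r) - 1 = (k - g)\<^sup>2 (F + r) + 2 k (g F - 1) + r g (2 k - g) + (2 k - 1 - g\<^sup>2 F)\<close>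
  lets \<open>r\<close> decrease in steps of \<open>1 / k\<^sup>2\<close> until it is negative.\<close>
lemma multiplier_elimination:
  assumes F: "F \<in> sym_mats" and g: "g \<in> sos" and gF: "pmat_scale g F - mat 1 \<in> M"
  shows "\<exists>\<epsilon>>0. F - mat (pconst \<epsilon>) \<in> M"
proof -
  obtain a where a: "a \<ge> 0" "mat (pconst a) - mat g \<in> M"
    using order_unit[of "mat g"] by auto
  obtain b where b: "b \<ge> 0" "mat (pconst b) - pmat_scale (g\<^sup>2) F \<in> M"
    using order_unit[of "pmat_scale (g\<^sup>2) F"] F by auto
  \<comment> \<open>Large enough that, modulo \<open>M\<close>, both \<open>g\<close> is at most
    \<open>2 k\<close> and \<open>g^2 F\<close> is at most \<open>2 k - 1\<close>.\<close>
  define k where "k = a + b + 1"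
  have k: "k \<ge> 1" "a \<le> 2 * k" "b \<le> 2 * k - 1" using a(1) b(1) by (auto simp: k_def)
  have g_le: "mat (pconst (2 * k) - g) \<in> M"
    using add_in[OF a(2) const_in[of "2 * k - a"]] k by (simp add: pconst_simps mat_simps)
  have g2F_le: "mat (pconst (2 * k - 1)) - pmat_scale (g\<^sup>2) F \<in> M"
    using add_in[OF b(2) const_in[of "2 * k - 1 - b"]] k by (simp add: pconst_simps mat_simps)
  have step: "F + mat (pconst (r - 1 / k\<^sup>2)) \<in> M" if r: "r \<ge> 0" "F + mat (pconst r) \<in> M" for r
  proof -
    let ?X = "pmat_scale ((pconst k - g)\<^sup>2) (F + mat (pconst r)) +
      pmat_scale (pconst (2 * k)) (pmat_scale g F - mat 1) +
      mat (pconst r * (g * (pconst (2 * k) - g))) +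
      (mat (pconst (2 * k - 1)) - pmat_scale (g\<^sup>2) F)"
    have "?X \<in> M"
      using k r(1)
      by (intro add_in[OF add_in[OF add_in]] scale_in mat_mult_in square_in_sos pconst_in_sos
          gF g g_le g2F_le r(2)) auto
    moreover have "?X = pmat_scale (pconst (k\<^sup>2)) (F + mat (pconst r)) - mat 1"
      by (simp add: vec_eq_iff pconst_simps pconst_2 power2_eq_square) (simp add: algebra_simps)
    ultimately have "pmat_scale (pconst (1 / k\<^sup>2)) (pmat_scale (pconst (k\<^sup>2)) (F + mat (pconst r)) - mat 1) \<in> M"
      by (intro scale_in pconst_in_sos) auto
    moreover have inv: "pconst (1 / k\<^sup>2) * pconst (k\<^sup>2) = 1"
      using k by (intro pconst_inverse) auto
    ultimately have "F + mat (pconst r) - mat (pconst (1 / k\<^sup>2)) \<in> M"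
      by (simp only: pmat_scale_simps(2,7,8,11) inv mult_1_right)
    then show ?thesis
      by (simp add: pconst_simps(4) mat_simps algebra_simps)
  qed
  obtain r where r: "r \<ge> 0" "mat (pconst r) + F \<in> M"
    using order_unit'[OF F] by metis
  define u where "u = 1 / k\<^sup>2"
  have "u > 0" using k by (simp add: u_def)
  \<comment> \<open>The guard says that the constant before the last decrement is still positive, as
    \<open>step\<close> requires it to be nonnegative.\<close>
  have descend: "F + mat (pconst (r - real n * u)) \<in> M" if "real n * u < r + u" for n
    using that
  proof (induction n)
    case 0
    then show ?case using r by (simp add: add.commute)
  next
    case (Suc n)
    then have "F + mat (pconst (r - real n * u)) \<in> M"
      using \<open>u > 0\<close> by (intro Suc.IH) (simp add: algebra_simps)
    then have "F + mat (pconst (r - real n * u - 1 / k\<^sup>2)) \<in> M"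
      using Suc.prems by (intro step) (auto simp: algebra_simps)
    moreover have "r - real n * u - 1 / k\<^sup>2 = r - real (Suc n) * u"
      by (simp add: u_def algebra_simps add_divide_distrib)
    ultimately show ?case by metis
  qed
  \<comment> \<open>The least \<open>n\<close> with \<open>r < n u\<close>. The constant after
    \<open>n - 1\<close> decrements is still nonnegative, so one further use of \<open>step\<close>
    makes it negative.\<close>
  define n where "n = nat \<lfloor>r / u\<rfloor> + 1"
  have n: "real n = of_int \<lfloor>r / u\<rfloor> + 1" using r(1) \<open>u > 0\<close> by (simp add: n_def)
  have "r / u < real n" "real n \<le> r / u + 1" unfolding n by linarith+
  then have n_u: "r < real n * u" "real n * u \<le> r + u"
    using \<open>u > 0\<close> by (simp_all add: field_simps)
  have "real (n - 1) * u < r + u" using n_u \<open>u > 0\<close> by (simp add: n_def algebra_simps)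
  then have "F + mat (pconst (r - real (n - 1) * u)) \<in> M" by (rule descend)
  moreover have "real (n - 1) * u \<le> r" using n_u by (simp add: n_def algebra_simps)
  ultimately have "F + mat (pconst (r - real (n - 1) * u - 1 / k\<^sup>2)) \<in> M" by (intro step) auto
  then have "F - mat (pconst (real n * u - r)) \<in> M"
    by (simp add: n_def u_def[symmetric] algebra_simps mat_simps pconst_simps(3-4))
  then show ?thesis using n_u by (intro exI[of _ "real n * u - r"]) auto
qed

end

subsection \<open>Maximal proper modules\<close>

locale maximal_wqm = archimedean_wqm +
  assumes proper: "- mat 1 \<notin> M"
    and maximal: "\<And>M'. weak_quadratic_module M' \<Longrightarrow> M \<subseteq> M' \<Longrightarrow> - mat 1 \<notin> M' \<Longrightarrow> M' = M"
begin

section \<open>Totality and closedness of a maximal proper module\<close>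

lemma neg_const_notin: "mat (pconst c) \<notin> M" if "c < 0"
proof
  assume "mat (pconst c) \<in> M"
  then have "mat (pconst (1 / - c) * pconst c) \<in> M"
    using that by (intro mat_mult_in pconst_in_sos) auto
  moreover have "pconst (1 / - c) * pconst c = - 1"
    using that pconst_inverse[of "- c"] by (simp add: pconst_simps(5) minus_equation_iff)
  ultimately have "mat (- 1) \<in> M" by metis
  then show False using proper by (simp add: mat_simps)
qed

text \<open>Otherwise \<open>adjoin H\<close> would be a strictly larger proper module, against
  maximality.\<close>

lemma outside_adjoin:
  assumes "H \<in> sym_mats" "H \<notin> M"
  obtains A s where "A \<in> M" "s \<in> sos" "- mat 1 = A + pmat_scale s H"
proof -
  have "- mat 1 \<in> adjoin H"
    using maximal[OF weak_quadratic_module_adjoin[OF assms(1)] subset_adjoin] assms(2) in_adjoin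
    by blast
  then show thesis using that unfolding adjoin_def by blast
qed

text \<open>If neither \<open>H\<close> nor \<open>- H\<close> belongs to \<open>M\<close>, eliminating \<open>H\<close> between the two
  representations of \<open>-1\<close> puts \<open>- (s + t)\<close>, hence \<open>- s\<close>, into \<open>M\<close>; as \<open>H\<close> is bounded,
  \<open>s H\<close> is then in \<open>M\<close> as well.\<close>
lemma total:
  assumes H: "H \<in> sym_mats"
  shows "H \<in> M \<or> - H \<in> M"
proof (rule ccontr)
  assume "\<not> ?thesis"
  then obtain A s B t where A: "A \<in> M" "s \<in> sos" "- mat 1 = A + pmat_scale s H"
    and B: "B \<in> M" "t \<in> sos" "- mat 1 = B + pmat_scale t (- H)"
    using outside_adjoin[of H] outside_adjoin[of "- H"] H by (metis sym_mats_diff(2))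
  have "pmat_scale t A + pmat_scale s B \<in> M"
    using A B by (intro add_in scale_in)
  also have "pmat_scale t A + pmat_scale s B = mat (- (s + t))"
  proof -
    have A': "A = - mat 1 - pmat_scale s H" and B': "B = - mat 1 + pmat_scale t H"
      using A(3) B(3) by (simp_all add: pmat_scale_simps algebra_simps)
    show ?thesis unfolding A' B'
      by (simp add: pmat_scale_simps mat_simps mult.commute)
  qed
  finally have "mat (- (s + t) + t) \<in> M"
    by (rule mat_add_in[OF _ mat_sos_in[OF B(2)]])
  then have neg_s: "mat (- s) \<in> M" by simp
  obtain c where c: "c \<ge> 0" "mat (pconst c) + H \<in> M"
    using order_unit'[OF H] by metis
  have "A + (pmat_scale s (mat (pconst c) + H) + mat (pconst c * (- s))) \<in> M"
    using c(1) by (intro add_in[OF A(1)] add_in[of "pmat_scale _ _"] scale_in[OF A(2) c(2)]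
        mat_mult_in[OF _ neg_s] pconst_in_sos)
  also have "A + (pmat_scale s (mat (pconst c) + H) + mat (pconst c * (- s))) = A + pmat_scale s H"
    by (simp add: pmat_scale_simps mat_simps mult.commute)
  finally show False using A(3) proper by simp
qed

text \<open>The closure \<open>M'\<close> of \<open>M\<close> along the constants is again a weak
  quadratic module. It is proper, since \<open>- 1\<close> in \<open>M'\<close> would put
  \<open>- 1/2\<close> into \<open>M\<close>; maximality gives \<open>M' = M\<close>.\<close>

lemma closed:
  assumes H: "H \<in> sym_mats" and near: "\<And>e. e > 0 \<Longrightarrow> H + mat (pconst e) \<in> M"
  shows "H \<in> M"
proof -
  define M' where "M' = {H \<in> sym_mats. \<forall>e>0. H + mat (pconst e) \<in> M}"
  have sub: "M \<subseteq> M'"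
    unfolding M'_def by (auto intro!: add_in const_in intro: in_sym)
  have "weak_quadratic_module M'"
    unfolding weak_quadratic_module_def
  proof (intro conjI ballI)
    show "M' \<subseteq> sym_mats" by (auto simp: M'_def)
    show "mat_sos \<subseteq> M'" using wqm sub by (auto simp: weak_quadratic_module_def)
  next
    fix A B assume AB: "A \<in> M'" "B \<in> M'"
    have "A + B + mat (pconst e) \<in> M" if "e > 0" for e
    proof -
      have "(A + mat (pconst (e/2))) + (B + mat (pconst (e/2))) \<in> M"
        using AB half_gt_zero[OF that] unfolding M'_def by (blast intro: add_in)
      moreover have "mat (pconst (e/2)) + mat (pconst (e/2)) = mat (pconst e)"
        by (simp flip: mat_simps pconst_simps)
      ultimately show ?thesis by (metis (no_types, lifting) add.assoc add.left_commute)
    qed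
    then show "A + B \<in> M'" using AB by (simp add: M'_def)
  next
    fix s :: "'a rpoly" and A assume s: "s \<in> sos" and A: "A \<in> M'"
    obtain c where c: "c \<ge> 0" "mat (pconst c) - mat s \<in> M"
      using order_unit[of "mat s"] by auto
    have "pmat_scale s A + mat (pconst e) \<in> M" if "e > 0" for e
    proof -
      \<comment> \<open>Chosen so that \<open>d c\<close> is at most \<open>e\<close>, with
        \<open>+ 1\<close> covering \<open>c = 0\<close>. Then \<open>s A + e\<close> is the sum of
        \<open>s (A + d)\<close>, \<open>d (c - s)\<close> and \<open>e - d c\<close>.\<close>
      define d where "d = e / (c + 1)"
      have d: "d > 0" "d * c \<le> e" using c(1) that by (simp_all add: d_def field_simps)
      have "pmat_scale s (A + mat (pconst d)) +
          (pmat_scale (pconst d) (mat (pconst c) - mat s) + mat (pconst (e - d * c))) \<in> M"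
        using A d c s
        by (intro add_in[of "pmat_scale s _"] add_in[of "pmat_scale (pconst d) _"] scale_in const_in
            pconst_in_sos) (auto simp: M'_def)
      then show ?thesis
        by (simp add: pmat_scale_simps pconst_simps mat_simps mult.commute)
    qed
    then show "pmat_scale s A \<in> M'" using A by (simp add: M'_def)
  qed
  moreover have "- mat 1 \<notin> M'"
  proof
    assume "- mat 1 \<in> M'"
    then have "- mat 1 + mat (pconst (1/2)) \<in> M" by (simp add: M'_def)
    moreover have "- 1 + pconst (1/2) = (pconst (- 1/2) :: 'a rpoly)"
      using pconst_simps(3)[of "-1" "1/2"] by (simp add: pconst_simps(2,5))
    ultimately have "mat (pconst (- 1/2)) \<in> M"
      by (metis mat_simps(1,3))
    then show False using neg_const_notin[of "-1/2"] by simp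
  qed
  ultimately have "M' = M" using maximal sub by blast
  then show ?thesis using assms by (auto simp: M'_def)
qed

text \<open>The functional \<open>L\<close> of the overview, read off as a cut: for symmetric
  \<open>H\<close> the set is nonempty and bounded above by the Archimedean property and
  properness.\<close>

definition state :: "('a, 'b) pmat \<Rightarrow> real" where
  "state H = Sup {c. H - mat (pconst c) \<in> M}"

text \<open>Constants just below the supremum are in the cut, and those above it are outside, where
  totality yields the opposite sign. Closedness passes to the supremum in both cases.\<close>

lemma state_bounds:
  assumes H: "H \<in> sym_mats"
  shows "H - mat (pconst (state H)) \<in> M" "mat (pconst (state H)) - H \<in> M"
proof -
  let ?S = "{c. H - mat (pconst c) \<in> M}"
  obtain b where b: "mat (pconst b) - H \<in> M" "mat (pconst b) + H \<in> M"
    using order_unit'[OF H] by metis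
  have le: "c \<le> b" if "c \<in> ?S" for c
  proof (rule ccontr)
    assume "\<not> c \<le> b"
    moreover have "(H - mat (pconst c)) + (mat (pconst b) - H) \<in> M"
      using that b by (intro add_in) auto
    ultimately show False
      using neg_const_notin[of "b - c"] by (simp add: pconst_simps mat_simps)
  qed
  have ne: "- b \<in> ?S" using b(2) by (simp add: pconst_simps mat_simps add.commute)
  have bdd: "bdd_above ?S" using le by (rule bdd_aboveI)
  show "H - mat (pconst (state H)) \<in> M"
  proof (rule closed)
    fix e :: real assume "e > 0"
    then obtain c where c: "c \<in> ?S" "state H - e < c"
      using less_cSup_iff[of ?S "state H - e"] ne bdd unfolding state_def by auto
    have "(H - mat (pconst c)) + mat (pconst (c - (state H - e))) \<in> M"
      using c by (intro add_in const_in) auto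
    then show "H - mat (pconst (state H)) + mat (pconst e) \<in> M"
      by (simp add: pconst_simps mat_simps algebra_simps)
  qed (use H in simp)
  show "mat (pconst (state H)) - H \<in> M"
  proof (rule closed)
    fix e :: real assume "e > 0"
    then have "state H + e \<notin> ?S"
      using cSup_upper[OF _ bdd, of "state H + e"] unfolding state_def by auto
    then have "- (H - mat (pconst (state H + e))) \<in> M"
      using total[of "H - mat (pconst (state H + e))"] H by auto
    then show "mat (pconst (state H)) - H + mat (pconst e) \<in> M"
      by (simp add: pconst_simps mat_simps algebra_simps)
  qed (use H in simp)
qed

text \<open>Two such constants would put both signs of their difference into \<open>M\<close>, one
  of them negative. All the algebraic rules for \<open>state\<close> follow from this
  uniqueness.\<close>

lemma state_eqI:
  assumes "H \<in> sym_mats" "H - mat (pconst c) \<in> M" "mat (pconst c) - H \<in> M"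
  shows "state H = c"
proof (rule ccontr)
  assume "state H \<noteq> c"
  moreover have "mat (pconst (c - state H)) \<in> M"
    using add_in[OF state_bounds(1)[OF assms(1)] assms(3)] by (simp add: pconst_simps mat_simps)
  moreover have "mat (pconst (state H - c)) \<in> M"
    using add_in[OF state_bounds(2)[OF assms(1)] assms(2)] by (simp add: pconst_simps mat_simps)
  ultimately show False
    using neg_const_notin[of "c - state H"] neg_const_notin[of "state H - c"] by linarith
qed

section \<open>Linearity and multiplicativity of the functional\<close>

lemma state_const: "state (mat (pconst c)) = c"
  using zero_in by (intro state_eqI) auto

lemma state_nonneg: "state H \<ge> 0" if "H \<in> M"
proof (rule ccontr)
  assume "\<not> state H \<ge> 0"
  then show False
    using add_in[OF state_bounds(2)[OF in_sym[OF that]] that] neg_const_notin[of "state H"] by simp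
qed

lemma state_add:
  assumes "A \<in> sym_mats" "B \<in> sym_mats"
  shows "state (A + B) = state A + state B"
  using add_in[OF state_bounds(1)[OF assms(1)] state_bounds(1)[OF assms(2)]]
    add_in[OF state_bounds(2)[OF assms(1)] state_bounds(2)[OF assms(2)]] assms
  by (intro state_eqI) (simp_all add: pconst_simps mat_simps algebra_simps)

lemma state_uminus: "state (- A) = - state A" if "A \<in> sym_mats"
  using state_add[OF that, of "- A"] state_const[of 0] that by (simp add: pconst_simps mat_0)

lemma state_diff:
  assumes "A \<in> sym_mats" "B \<in> sym_mats"
  shows "state (A - B) = state A - state B"
  using state_add[OF assms(1) sym_mats_diff(2)[OF assms(2)]] state_uminus[OF assms(2)] by simp

lemma state_sum:
  assumes "\<And>i. i \<in> S \<Longrightarrow> A i \<in> sym_mats"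
  shows "state (sum A S) = (\<Sum>i\<in>S. state (A i))"
  using assms state_const[of 0]
  by (induction S rule: infinite_finite_induct)
     (auto simp: state_add sum_sym_mats pconst_simps mat_0)

lemma state_scale_const_nonneg:
  assumes "A \<in> sym_mats" "c \<ge> 0"
  shows "state (pmat_scale (pconst c) A) = c * state A"
  using scale_in[OF pconst_in_sos[OF assms(2)] state_bounds(1)[OF assms(1)]]
    scale_in[OF pconst_in_sos[OF assms(2)] state_bounds(2)[OF assms(1)]] assms
  by (intro state_eqI) (simp_all add: pmat_scale_simps pconst_simps)

text \<open>Both \<open>H - state H\<close> and its negative lie in \<open>M\<close>, and
  multiplication by \<open>s\<close> keeps them there; so \<open>state\<close> takes the same value
  on \<open>s H\<close> and on the scalar matrix \<open>s (state H)\<close>.\<close>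

lemma state_scale_sos:
  assumes H: "H \<in> sym_mats" and s: "s \<in> sos"
  shows "state (pmat_scale s H) = state (mat s) * state H"
proof -
  let ?h = "state H"
  have scaled: "state (mat (s * pconst c)) = state (mat s) * c" for c
  proof (cases "c \<ge> 0")
    case True
    then show ?thesis
      using state_scale_const_nonneg[of "mat s" c] by (simp add: pmat_scale_simps mult.commute)
  next
    case False
    then show ?thesis
      using state_scale_const_nonneg[of "mat s" "- c"] state_uminus[of "mat (s * pconst c)"]
      by (simp add: pmat_scale_simps pconst_simps mat_simps mult.commute)
  qed
  have "state (pmat_scale s (H - mat (pconst ?h))) \<ge> 0" "state (pmat_scale s (mat (pconst ?h) - H)) \<ge> 0"
    using state_bounds[OF H] s by (auto intro!: state_nonneg scale_in)
  then have "state (pmat_scale s H) = state (mat (s * pconst ?h))"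
    using H by (simp add: pmat_scale_simps state_diff)
  then show ?thesis by (simp add: scaled)
qed

text \<open>Every polynomial is a difference of squares, \<open>4 p = (p + 1)\<^sup>2 - (p - 1)\<^sup>2\<close>.\<close>
lemma state_scale:
  assumes H: "H \<in> sym_mats"
  shows "state (pmat_scale p H) = state (mat p) * state H"
proof -
  define q r where "q = (p + 1)\<^sup>2" and "r = (p - 1)\<^sup>2"
  have p: "p = pconst (1/4) * (q - r)"
  proof -
    have "q - r = pconst 4 * p"
      by (simp add: q_def r_def power2_eq_square algebra_simps pconst_4)
    then show ?thesis
      by (simp add: pconst_inverse flip: mult.assoc)
  qed
  have quarter: "state (pmat_scale p X) = 1/4 * (state (pmat_scale q X) - state (pmat_scale r X))"
    if "X \<in> sym_mats" for X
  proof -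
    have "pmat_scale p X = pmat_scale (pconst (1/4)) (pmat_scale q X - pmat_scale r X)"
      by (subst p) (simp add: pmat_scale_simps right_diff_distrib)
    then show ?thesis
      using that by (simp add: state_scale_const_nonneg state_diff)
  qed
  have p_eq: "state (mat p) = 1/4 * (state (mat q) - state (mat r))"
    using quarter[of "mat 1"] by (simp add: pmat_scale_simps)
  have "q \<in> sos" "r \<in> sos"
    unfolding q_def r_def by (rule square_in_sos)+
  then show ?thesis
    unfolding quarter[OF H] p_eq by (simp add: state_scale_sos[OF H] left_diff_distrib)
qed

text \<open>Expanding \<open>H\<close> in symmetrised matrix units \<open>E i j\<close> and applying
  \<open>state_scale\<close> splits each term into the value of an entry of \<open>H\<close> at
  \<open>a\<close> and the number \<open>state (E i j)\<close>. The latter numbers form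
  \<open>B\<close>.\<close>

lemma state_eq_trace:
  obtains a :: "real ^ 'a" and B :: "real ^ 'b ^ 'b"
  where "psd B" "B \<noteq> 0" "\<And>H. H \<in> sym_mats \<Longrightarrow> state H = trace (mat_eval H a ** B)"
proof -
  define a :: "real ^ 'a" where "a = (\<chi> i. state (mat (pvar i)))"
  define e :: "'b \<Rightarrow> 'b \<Rightarrow> 'b \<Rightarrow> 'b \<Rightarrow> 'a rpoly" where
    "e i j k l = (if k = i \<and> l = j then pconst (1/2) else 0)" for i j k l
  \<comment> \<open>Half the sum of the \<open>(i, j)\<close> and \<open>(j, i)\<close> matrix
    units. For \<open>i = j\<close> the two halves add up to the unit itself.\<close>
  define E :: "'b \<Rightarrow> 'b \<Rightarrow> ('a, 'b) pmat" where
    "E i j = (\<chi> k l. e i j k l + e j i k l)" for i j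
  define B :: "real ^ 'b ^ 'b" where "B = (\<chi> i j. state (E i j))"
  have E_nth: "E i j $ k $ l = e i j k l + e j i k l" for i j k l
    by (simp add: E_def)
  have e_flip: "e j i l k = e i j k l" for i j k l
    by (simp add: e_def conj_commute)
  have E_sym: "E i j \<in> sym_mats" for i j
  proof -
    have "E i j $ k $ l = E i j $ l $ k" for k l
      unfolding E_nth e_flip[of i j k l] e_flip[of j i k l] by (rule add.commute)
    then show ?thesis by (simp only: in_sym_mats_iff simp_thms)
  qed
  have E_comm: "E i j = E j i" for i j
    unfolding vec_eq_iff E_nth by (intro allI add.commute)
  have B_nth: "B $ i $ j = state (E i j)" for i j
    by (simp add: B_def)
  have B_sym: "B \<in> sym_mats"
    unfolding in_sym_mats_iff B_nth using E_comm by metis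
  have eval: "state (mat p) = peval p a" for p
    unfolding a_def
  proof (rule rpoly_hom_eq_peval)
    show "state (mat (p * q)) = state (mat p) * state (mat q)" for p q
      using state_scale[of "mat q" p] by (simp add: pmat_scale_simps)
  qed (simp_all add: state_const mat_simps state_add)
  have decomp: "H = (\<Sum>i\<in>UNIV. \<Sum>j\<in>UNIV. pmat_scale (H $ i $ j) (E i j))"
    if H: "H \<in> sym_mats" for H :: "('a, 'b) pmat"
  proof -
    have "(\<Sum>i\<in>UNIV. \<Sum>j\<in>UNIV. pmat_scale (H $ i $ j) (E i j)) $ k $ l = H $ k $ l" for k l
    proof -
      have "(\<Sum>i\<in>UNIV. \<Sum>j\<in>UNIV. pmat_scale (H $ i $ j) (E i j)) $ k $ l =
        (\<Sum>i\<in>UNIV. \<Sum>j\<in>UNIV. (if j = l then if i = k then pconst (1/2) * H $ k $ l else 0 else 0) +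
           (if j = k then if i = l then pconst (1/2) * H $ l $ k else 0 else 0))"
        unfolding sum_component pmat_scale_nth E_nth
        by (intro sum.cong refl) (auto simp: e_def distrib_left mult.commute)
      also have "\<dots> = pconst (1/2) * H $ k $ l + pconst (1/2) * H $ l $ k"
        by (simp add: sum.distrib)
      also have "\<dots> = H $ k $ l"
        using H by (simp add: in_sym_mats_iff pconst_half_add)
      finally show ?thesis .
    qed
    then show ?thesis by (simp add: vec_eq_iff)
  qed
  have state: "state H = trace (mat_eval H a ** B)" if H: "H \<in> sym_mats" for H
  proof -
    have "state H = (\<Sum>i\<in>UNIV. \<Sum>j\<in>UNIV. state (pmat_scale (H $ i $ j) (E i j)))"
      using arg_cong[OF decomp[OF H], of state] by (simp add: state_sum E_sym sum_sym_mats)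
    then show ?thesis
      by (simp add: trace_mat_eval[OF B_sym] state_scale[OF E_sym] eval B_nth)
  qed
  have "0 \<le> v \<bullet> (B *v v)" for v
  proof -
    \<comment> \<open>An arbitrary row: placing \<open>v\<close> there and zeros elsewhere makes
      \<open>H^T H\<close> the rank-one matrix \<open>v v^T\<close>, on which \<open>state\<close>
      is the quadratic form of \<open>B\<close>.\<close>
    define i0 :: 'b where "i0 = undefined"
    define H :: "('a, 'b) pmat" where "H = (\<chi> k l. if k = i0 then pconst (v $ l) else 0)"
    have H: "(transpose H ** H) $ i $ j = pconst (v $ i * v $ j)" for i j
    proof -
      have "(transpose H ** H) $ i $ j = (\<Sum>k\<in>UNIV. if k = i0 then pconst (v $ i * v $ j) else 0)"
        unfolding transpose_mult_nth by (intro sum.cong) (auto simp: H_def pconst_simps)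
      then show ?thesis by simp
    qed
    have "0 \<le> state (transpose H ** H)"
      by (intro state_nonneg square_in)
    also have "\<dots> = (\<Sum>i\<in>UNIV. \<Sum>j\<in>UNIV. v $ i * v $ j * B $ i $ j)"
      using in_sym[OF square_in] by (simp add: state trace_mat_eval[OF B_sym] H)
    also have "\<dots> = v \<bullet> (B *v v)"
      by (simp add: inner_vec_def matrix_vector_mult_def sum_distrib_left algebra_simps)
    finally show ?thesis .
  qed
  then have psd: "psd B" using B_sym by (simp add: psd_def)
  \<comment> \<open>With \<open>B = 0\<close> the trace formula would give \<open>state\<close> the
    value 0 at the identity, where it is 1.\<close>
  have "B \<noteq> 0"
    using state[of "mat 1"] state_const[of 1] by (auto simp: trace_mat_eval[OF B_sym] pconst_simps)
  then show thesis using psd state by (intro that)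
qed

end

text \<open>Zorn's lemma: two elements of the union of a chain lie in a common member, so the union
  stays a module, and properness only concerns the single element \<open>- 1\<close>. Nonempty
  chains are taken because the union must contain \<open>M\<close>.\<close>

lemma (in archimedean_wqm) extend_maximal:
  assumes "- mat 1 \<notin> M"
  obtains M' where "M \<subseteq> M'" "maximal_wqm M'"
proof -
  define \<A> where "\<A> = {N. weak_quadratic_module N \<and> M \<subseteq> N \<and> - mat 1 \<notin> N}"
  have "\<exists>N\<in>\<A>. \<forall>X\<in>\<A>. N \<subseteq> X \<longrightarrow> X = N"
  proof (rule subset_Zorn_nonempty)
    show "\<A> \<noteq> {}" using wqm assms by (auto simp: \<A>_def)
  next
    fix \<C> assume "\<C> \<noteq> {}" and chain: "subset.chain \<A> \<C>"
    then obtain N0 where N0: "N0 \<in> \<C>" by blast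
    have in_A: "N \<in> \<A>" if "N \<in> \<C>" for N
      using chain that by (auto simp: subset_chain_def)
    have "A + B \<in> \<Union>\<C>" if "A \<in> \<Union>\<C>" "B \<in> \<Union>\<C>" for A B
    proof -
      obtain X Y where XY: "X \<in> \<C>" "A \<in> X" "Y \<in> \<C>" "B \<in> Y" using \<open>A \<in> \<Union>\<C>\<close> \<open>B \<in> \<Union>\<C>\<close> by blast
      then have "X \<subseteq> Y \<or> Y \<subseteq> X" using chain by (auto simp: subset_chain_def)
      then obtain Z where "Z \<in> \<C>" "A \<in> Z" "B \<in> Z" using XY by blast
      then show ?thesis using in_A[of Z] by (auto simp: \<A>_def weak_quadratic_module_def)
    qed
    moreover have "pmat_scale s H \<in> \<Union>\<C>" if "s \<in> sos" "H \<in> \<Union>\<C>" for s H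
      using that in_A unfolding \<A>_def weak_quadratic_module_def by blast
    moreover have "\<Union>\<C> \<subseteq> sym_mats" "mat_sos \<subseteq> \<Union>\<C>" "M \<subseteq> \<Union>\<C>" "- mat 1 \<notin> \<Union>\<C>"
      using in_A N0 unfolding \<A>_def weak_quadratic_module_def by blast+
    ultimately show "\<Union>\<C> \<in> \<A>"
      unfolding \<A>_def weak_quadratic_module_def by blast
  qed
  then obtain N where N: "N \<in> \<A>" and max: "\<And>X. X \<in> \<A> \<Longrightarrow> N \<subseteq> X \<Longrightarrow> X = N" by blast
  have "maximal_wqm N"
  proof
    show "weak_quadratic_module N" "- mat 1 \<notin> N" using N by (auto simp: \<A>_def)
    show "\<exists>R. mat (pconst (R\<^sup>2) - pnorm_sq) \<in> N" using ball N by (auto simp: \<A>_def)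
    show "M' = N" if "weak_quadratic_module M'" "N \<subseteq> M'" "- mat 1 \<notin> M'" for M'
      using that N by (intro max) (auto simp: \<A>_def)
  qed
  then show thesis using that N by (auto simp: \<A>_def)
qed

theorem theorem6p6:
  fixes \<G> :: "('d::finite, 'n::finite) pmat set" and F :: "('d, 'n) pmat"
  assumes "\<G> \<subseteq> sym_mats"
    and "F \<in> sym_mats"
    and "\<exists>R::real. mat (pconst (R\<^sup>2) - pnorm_sq) \<in> wqm_generated \<G>"
  shows "(\<forall>(a :: real ^ 'd) (B :: real ^ 'n ^ 'n).
            psd B \<and> B \<noteq> 0 \<and> (\<forall>G\<in>\<G>. trace (mat_eval G a ** B) \<ge> 0)
            \<longrightarrow> trace (mat_eval F a ** B) > 0)
     \<longleftrightarrow> (\<exists>\<epsilon>::real. \<epsilon> > 0 \<and> F - mat (pconst \<epsilon>) \<in> wqm_generated \<G>)"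
proof
  assume "\<exists>\<epsilon>::real. \<epsilon> > 0 \<and> F - mat (pconst \<epsilon>) \<in> wqm_generated \<G>"
  then obtain \<epsilon> where \<epsilon>: "\<epsilon> > 0" "F - mat (pconst \<epsilon>) \<in> wqm_generated \<G>" by blast
  show "\<forall>(a :: real ^ 'd) (B :: real ^ 'n ^ 'n).
            psd B \<and> B \<noteq> 0 \<and> (\<forall>G\<in>\<G>. trace (mat_eval G a ** B) \<ge> 0)
            \<longrightarrow> trace (mat_eval F a ** B) > 0"
  proof (intro allI impI, elim conjE)
    fix a :: "real ^ 'd" and B :: "real ^ 'n ^ 'n"
    assume B: "psd B" "B \<noteq> 0" and G: "\<forall>G\<in>\<G>. trace (mat_eval G a ** B) \<ge> 0"
    have sym: "B \<in> sym_mats" using B by (simp add: psd_def)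
    have "0 \<le> trace (mat_eval (F - mat (pconst \<epsilon>)) a ** B)"
      by (rule trace_nonneg_wqm_generated[OF B(1) assms(1) G \<epsilon>(2)])
    also have "\<dots> = trace (mat_eval F a ** B) - \<epsilon> * trace B"
      by (simp add: trace_mat_eval[OF sym] trace_def[of B] left_diff_distrib sum_subtractf
          sum_distrib_left if_distrib[where f = "\<lambda>p. peval p a"]
          if_distrib[where f = "\<lambda>x. x * _"] cong: if_cong)
    finally show "trace (mat_eval F a ** B) > 0"
      using mult_pos_pos[OF \<epsilon>(1) trace_psd_pos[OF B]] by linarith
  qed
next
  assume pos: "\<forall>(a :: real ^ 'd) (B :: real ^ 'n ^ 'n).
            psd B \<and> B \<noteq> 0 \<and> (\<forall>G\<in>\<G>. trace (mat_eval G a ** B) \<ge> 0)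
            \<longrightarrow> trace (mat_eval F a ** B) > 0"
  interpret N: archimedean_wqm "wqm_generated \<G>"
    using assms weak_quadratic_module_wqm_generated by unfold_locales auto
  \<comment> \<open>The adjoined module inherits the ball condition from the smaller one.\<close>
  interpret N': archimedean_wqm "N.adjoin (- F)"
    using N.weak_quadratic_module_adjoin[of "- F"] assms(2) N.ball N.subset_adjoin[of "- F"]
    by unfold_locales auto
  show "\<exists>\<epsilon>::real. \<epsilon> > 0 \<and> F - mat (pconst \<epsilon>) \<in> wqm_generated \<G>"
  proof (cases "- mat 1 \<in> N.adjoin (- F)")
    case True
    then obtain A g where A: "A \<in> wqm_generated \<G>" "g \<in> sos" "- mat 1 = A + pmat_scale g (- F)"
      unfolding N.adjoin_def by blast
    then have "pmat_scale g F - mat 1 = A"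
      by (simp add: pmat_scale_simps algebra_simps)
    then show ?thesis using N.multiplier_elimination[OF assms(2) A(2)] A(1) by simp
  next
    case False
    then obtain M where sub: "N.adjoin (- F) \<subseteq> M" and "maximal_wqm M"
      by (rule N'.extend_maximal)
    interpret M: maximal_wqm M by fact
    obtain a :: "real ^ 'd" and B :: "real ^ 'n ^ 'n" where B: "psd B" "B \<noteq> 0"
      and state: "\<And>H. H \<in> sym_mats \<Longrightarrow> M.state H = trace (mat_eval H a ** B)"
      using M.state_eq_trace by blast
    \<comment> \<open>Since \<open>M\<close> contains both \<open>\<G>\<close> and
      \<open>- F\<close>, the pair \<open>(a, B)\<close> satisfies the premises of the positivity
      assumption while the trace for \<open>F\<close> is at most 0.\<close>
    have "\<G> \<subseteq> M"
      using hull_subset[of \<G> weak_quadratic_module] N.subset_adjoin[of "- F"] sub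
      unfolding wqm_generated_def by blast
    then have "trace (mat_eval G a ** B) \<ge> 0" if "G \<in> \<G>" for G
      using M.state_nonneg[of G] state[of G] that assms(1) by (metis subsetD)
    then have "trace (mat_eval F a ** B) > 0" using pos B by blast
    moreover have "M.state (- F) \<ge> 0"
      using sub N.in_adjoin by (intro M.state_nonneg) blast
    ultimately show ?thesis
      using state[OF assms(2)] M.state_uminus[OF assms(2)] by simp
  qed
qed

end
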